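(* Let $\mathcal{H}$ be a separable Hilbert space, and let $\mathcal{G}=\{g_j\}_{j\ge 1}$ be any Bessel sequence in $\mathcal{H}$ with optimal Bessel bound $C_{\mathcal{G}}>0$. Then, for each $D=[d_{ij}]_{i,j\ge 1}\in\mathcal{B}^{s}(\ell^2,\ell^\infty)$, the limit $$\lim D\mathcal{G}:=\lim_{i\to\infty}\sum_{j=1}^{\infty}d_{ij}g_j$$ exists in $\mathcal{H}$ (in norm) and, moreover, the mapping $$\mathcal{R}_{\mathcal{G}}:\mathcal{B}^{s}(\ell^2,\ell^\infty)\to\mathcal{H},\qquad \mathcal{R}_{\mathcal{G}}(D)=\lim D\mathcal{G},$$ is a well-defined bounded (linear) operator whose norm is precisely $\sqrt{C_{\mathcal{G}}}$.
   Context: Hilbert spaces are complex. $\ell^2=\ell^2(\mathbb{N})$ is the space of square-summable complex sequences indexed by $j\ge 1$. A sequence $\mathcal{G}=\{g_j\}_{j\ge1}$ in a Hilbert space $\mathcal{H}$ is a Bessel sequence if there is $C<\infty$ with $\sum_{j\ge1}|\langle h,g_j\rangle|^2\le C\|h\|^2$ for all $h\in\mathcal{H}$; the smallest such $C$ is the optimal Bessel bound $C_{\mathcal{G}}$. The space $\mathcal{B}^{s}(\ell^2,\ell^\infty)$ is the set of infinite complex matrices $D=[d_{ij}]_{i\ge1,j\ge1}$ such that each row $r_i=(d_{i1},d_{i2},\dots)$ belongs to $\ell^2$ and there exists $t\in\ell^2$ with $\lim_{i\to\infty}\|r_i-t\|_{\ell^2}=0$. It is endowed with the norm $\|D\|_{\ell^2\to\ell^\infty}=\sup_{i\ge1}\|r_i\|_{\ell^2}$.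 *)

theory Defs
  imports "HOL-Analysis.Analysis"
begin

section \<open>Complex Hilbert spaces\<close>

class complex_normed_vector = real_normed_vector +
  fixes scaleC :: "complex \<Rightarrow> 'a \<Rightarrow> 'a"  (infixr \<open>*\<^sub>C\<close> 75)
  assumes scaleC_add_right: "a *\<^sub>C (x + y) = a *\<^sub>C x + a *\<^sub>C y"
    and scaleC_add_left: "(a + b) *\<^sub>C x = a *\<^sub>C x + b *\<^sub>C x"
    and scaleC_scaleC: "a *\<^sub>C b *\<^sub>C x = (a * b) *\<^sub>C x"
    and scaleR_scaleC: "r *\<^sub>R x = complex_of_real r *\<^sub>C x"
    and norm_scaleC: "norm (a *\<^sub>C x) = cmod a * norm x"

text \<open>
  The inner product is linear in the first argument. The axiom \<open>cinner_self\<close> says that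
  it is positive definite and that the norm of the space is the one it induces.
\<close>

class complex_inner = complex_normed_vector +
  fixes cinner :: "'a \<Rightarrow> 'a \<Rightarrow> complex"
  assumes cinner_commute: "cinner x y = cnj (cinner y x)"
    and cinner_add_left: "cinner (x + y) z = cinner x z + cinner y z"
    and cinner_scaleC_left: "cinner (a *\<^sub>C x) y = a * cinner x y"
    and cinner_self: "cinner x x = complex_of_real ((norm x)\<^sup>2)"

class chilbert_space = complex_inner + complete_space

instantiation complex :: chilbert_space
begin
definition scaleC_complex :: "complex \<Rightarrow> complex \<Rightarrow> complex"
  where "scaleC_complex a x = a * x"
definition cinner_complex :: "complex \<Rightarrow> complex \<Rightarrow> complex"
  where "cinner_complex x y = x * cnj y"
instance
proof
  fix a b x y z :: complex and r :: real
  show "a *\<^sub>C (x + y) = a *\<^sub>C x + a *\<^sub>C y" "(a + b) *\<^sub>C x = a *\<^sub>C x + b *\<^sub>C x"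
    "a *\<^sub>C b *\<^sub>C x = (a * b) *\<^sub>C x"
    by (simp_all add: scaleC_complex_def algebra_simps)
  show "r *\<^sub>R x = complex_of_real r *\<^sub>C x" "norm (a *\<^sub>C x) = cmod a * norm x"
    by (simp_all add: scaleC_complex_def scaleR_conv_of_real norm_mult)
  show "cinner x y = cnj (cinner y x)" "cinner (x + y) z = cinner x z + cinner y z"
    "cinner (a *\<^sub>C x) y = a * cinner x y"
    by (simp_all add: scaleC_complex_def cinner_complex_def algebra_simps)
  show "cinner x x = complex_of_real ((norm x)\<^sup>2)"
    unfolding cinner_complex_def by (rule complex_norm_square[symmetric])
qed
end


section \<open>Bessel sequences\<close>

text \<open>Sequences are indexed by \<open>nat\<close>, so the index \<open>j\<close> here is \<open>j + 1\<close> in a numbering from 1.\<close>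

definition bessel_bound :: "(nat \<Rightarrow> 'a::complex_inner) \<Rightarrow> real \<Rightarrow> bool"
  where "bessel_bound g C \<longleftrightarrow>
    (\<forall>h. summable (\<lambda>j. (cmod (cinner h (g j)))\<^sup>2) \<and>
         (\<Sum>j. (cmod (cinner h (g j)))\<^sup>2) \<le> C * (norm h)\<^sup>2)"

definition bessel_sequence :: "(nat \<Rightarrow> 'a::complex_inner) \<Rightarrow> bool"
  where "bessel_sequence g \<longleftrightarrow> (\<exists>C. bessel_bound g C)"

text \<open>
  The condition \<open>0 \<le> C\<close> matters only for the zero space, where every real number is a bound.
\<close>

definition optimal_bessel_bound :: "(nat \<Rightarrow> 'a::complex_inner) \<Rightarrow> real"
  where "optimal_bessel_bound g = (LEAST C. 0 \<le> C \<and> bessel_bound g C)"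

lemma optimal_bessel_bound:
  assumes "bessel_sequence g"
  shows "0 \<le> optimal_bessel_bound g" "bessel_bound g (optimal_bessel_bound g)"
    and "0 \<le> C \<Longrightarrow> bessel_bound g C \<Longrightarrow> optimal_bessel_bound g \<le> C"
proof -
  define S where "S = {C. 0 \<le> C \<and> bessel_bound g C}"
  obtain C0 where C0: "bessel_bound g C0"
    using assms by (auto simp: bessel_sequence_def)
  have "bessel_bound g (max 0 C0)"
    unfolding bessel_bound_def
  proof (intro allI conjI)
    fix h
    show "summable (\<lambda>j. (cmod (cinner h (g j)))\<^sup>2)"
      using C0 by (auto simp: bessel_bound_def)
    have "(\<Sum>j. (cmod (cinner h (g j)))\<^sup>2) \<le> C0 * (norm h)\<^sup>2"
      using C0 by (auto simp: bessel_bound_def)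
    also have "\<dots> \<le> max 0 C0 * (norm h)\<^sup>2"
      by (rule mult_right_mono) auto
    finally show "(\<Sum>j. (cmod (cinner h (g j)))\<^sup>2) \<le> max 0 C0 * (norm h)\<^sup>2" .
  qed
  then have ne: "S \<noteq> {}"
    by (auto simp: S_def intro!: exI[of _ "max 0 C0"])
  have bdd: "bdd_below S"
    by (auto simp: S_def bdd_below_def)
  have "closed S"
  proof -
    have "S = {0..} \<inter> (\<Inter>h. {C. (\<Sum>j. (cmod (cinner h (g j)))\<^sup>2) \<le> C * (norm h)\<^sup>2})"
      using C0 by (auto simp: S_def bessel_bound_def)
    also have "closed \<dots>"
      by (intro closed_Int closed_INT ballI closed_Collect_le continuous_intros)
    finally show ?thesis .
  qed
  then have mem: "Inf S \<in> S"
    using closed_contains_Inf ne bdd by blast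
  have eq: "optimal_bessel_bound g = Inf S"
    unfolding optimal_bessel_bound_def
    by (rule Least_equality) (use mem cInf_lower[OF _ bdd] in \<open>auto simp: S_def\<close>)
  show "0 \<le> optimal_bessel_bound g" "bessel_bound g (optimal_bessel_bound g)"
    using mem by (auto simp: eq S_def)
  show "optimal_bessel_bound g \<le> C" if "0 \<le> C" "bessel_bound g C"
    using that cInf_lower[OF _ bdd] by (auto simp: eq S_def)
qed


section \<open>Square-summable sequences\<close>

definition ell2 :: "(nat \<Rightarrow> complex) set"
  where "ell2 = {x. summable (\<lambda>j. (cmod (x j))\<^sup>2)}"

definition ell2_norm :: "(nat \<Rightarrow> complex) \<Rightarrow> real"
  where "ell2_norm x = sqrt (\<Sum>j. (cmod (x j))\<^sup>2)"

lemma ell2_norm_nonneg: "x \<in> ell2 \<Longrightarrow> 0 \<le> ell2_norm x"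
  by (simp add: ell2_norm_def ell2_def suminf_nonneg)

lemma ell2_zero: "(\<lambda>j. 0) \<in> ell2" "ell2_norm (\<lambda>j. 0) = 0"
  by (simp_all add: ell2_def ell2_norm_def)

lemma ell2_norm_eq_0:
  assumes "x \<in> ell2" "ell2_norm x = 0"
  shows "x j = 0"
  using assms suminf_eq_zero_iff[of "\<lambda>j. (cmod (x j))\<^sup>2"]
  by (simp add: ell2_def ell2_norm_def)

lemma ell2_scale:
  assumes "x \<in> ell2"
  shows "(\<lambda>j. a * x j) \<in> ell2" "ell2_norm (\<lambda>j. a * x j) = cmod a * ell2_norm x"
proof -
  have s: "summable (\<lambda>j. (cmod (x j))\<^sup>2)"
    using assms by (simp add: ell2_def)
  show "(\<lambda>j. a * x j) \<in> ell2"
    using summable_mult[OF s, of "(cmod a)\<^sup>2"]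
    by (simp add: ell2_def norm_mult power_mult_distrib)
  show "ell2_norm (\<lambda>j. a * x j) = cmod a * ell2_norm x"
    using suminf_mult[OF s, of "(cmod a)\<^sup>2"]
    by (simp add: ell2_norm_def norm_mult power_mult_distrib real_sqrt_mult)
qed

lemma ell2_add:
  assumes "x \<in> ell2" "y \<in> ell2"
  shows "(\<lambda>j. x j + y j) \<in> ell2"
    and "ell2_norm (\<lambda>j. x j + y j) \<le> ell2_norm x + ell2_norm y"
proof -
  let ?B = "ell2_norm x + ell2_norm y"
  have part: "L2_set (\<lambda>j. cmod (z j)) {..<n} \<le> ell2_norm z" if "z \<in> ell2" for z n
    using that sum_le_suminf[of "\<lambda>j. (cmod (z j))\<^sup>2" "{..<n}"]
    by (simp add: L2_set_def ell2_norm_def ell2_def)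
  have B: "0 \<le> ?B"
    using assms by (simp add: ell2_norm_nonneg)
  have le: "(\<Sum>j<n. (cmod (x j + y j))\<^sup>2) \<le> ?B\<^sup>2" for n
  proof -
    have "L2_set (\<lambda>j. cmod (x j + y j)) {..<n} \<le>
        L2_set (\<lambda>j. cmod (x j) + cmod (y j)) {..<n}"
      by (rule L2_set_mono) (auto intro: norm_triangle_ineq)
    also have "\<dots> \<le> L2_set (\<lambda>j. cmod (x j)) {..<n} + L2_set (\<lambda>j. cmod (y j)) {..<n}"
      by (rule L2_set_triangle_ineq)
    also have "\<dots> \<le> ?B"
      by (intro add_mono part assms)
    finally show ?thesis
      by (auto simp: L2_set_def intro: sqrt_le_D)
  qed
  have s: "summable (\<lambda>j. (cmod (x j + y j))\<^sup>2)"
    by (rule summableI_nonneg_bounded[OF _ le]) simp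
  then show "(\<lambda>j. x j + y j) \<in> ell2"
    by (simp add: ell2_def)
  show "ell2_norm (\<lambda>j. x j + y j) \<le> ?B"
    unfolding ell2_norm_def[of "\<lambda>j. x j + y j"]
    by (rule real_le_lsqrt[OF B]) (rule suminf_le_const[OF s le])
qed

lemma ell2_diff:
  assumes "x \<in> ell2" "y \<in> ell2"
  shows "(\<lambda>j. x j - y j) \<in> ell2"
  using ell2_add(1)[OF assms(1) ell2_scale(1)[OF assms(2), of "-1"]] by simp


section \<open>The matrix space \<open>B\<^sup>s(\<ell>\<^sup>2, \<ell>\<^sup>\<infinity>)\<close>\<close>

definition Bs :: "(nat \<Rightarrow> nat \<Rightarrow> complex) set"
  where "Bs = {D. (\<forall>i. D i \<in> ell2) \<and>
    (\<exists>t\<in>ell2. (\<lambda>i. ell2_norm (\<lambda>j. D i j - t j)) \<longlonglongrightarrow> 0)}"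

lemma Bs_zero: "(\<lambda>i j. 0) \<in> Bs"
  by (auto simp: Bs_def ell2_zero intro!: bexI[of _ "\<lambda>j. 0"])

lemma Bs_row: "D \<in> Bs \<Longrightarrow> D i \<in> ell2"
  by (simp add: Bs_def)

lemma Bs_scale:
  assumes "D \<in> Bs"
  shows "(\<lambda>i j. a * D i j) \<in> Bs"
proof -
  obtain t where t: "t \<in> ell2" "(\<lambda>i. ell2_norm (\<lambda>j. D i j - t j)) \<longlonglongrightarrow> 0"
    and row: "\<And>i. D i \<in> ell2"
    using assms by (auto simp: Bs_def)
  have "ell2_norm (\<lambda>j. a * D i j - a * t j) = cmod a * ell2_norm (\<lambda>j. D i j - t j)" for i
    using ell2_scale(2)[OF ell2_diff[OF row t(1)], of a] by (simp add: algebra_simps)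
  then have "(\<lambda>i. ell2_norm (\<lambda>j. a * D i j - a * t j)) \<longlonglongrightarrow> 0"
    using tendsto_mult_left[OF t(2), of "cmod a"] by simp
  then show ?thesis
    using row t(1) by (auto simp: Bs_def ell2_scale intro!: bexI[of _ "\<lambda>j. a * t j"])
qed

lemma Bs_add:
  assumes "D \<in> Bs" "E \<in> Bs"
  shows "(\<lambda>i j. D i j + E i j) \<in> Bs"
proof -
  obtain t u where t: "t \<in> ell2" "(\<lambda>i. ell2_norm (\<lambda>j. D i j - t j)) \<longlonglongrightarrow> 0"
    and u: "u \<in> ell2" "(\<lambda>i. ell2_norm (\<lambda>j. E i j - u j)) \<longlonglongrightarrow> 0"
    and row: "\<And>i. D i \<in> ell2" "\<And>i. E i \<in> ell2"
    using assms by (auto simp: Bs_def)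
  have d: "(\<lambda>j. D i j - t j) \<in> ell2" "(\<lambda>j. E i j - u j) \<in> ell2" for i
    by (simp_all add: ell2_diff row t u)
  have eq: "(\<lambda>j. D i j + E i j - (t j + u j)) = (\<lambda>j. (D i j - t j) + (E i j - u j))" for i
    by (simp add: algebra_simps)
  have "(\<lambda>i. ell2_norm (\<lambda>j. D i j + E i j - (t j + u j))) \<longlonglongrightarrow> 0"
  proof (rule tendsto_sandwich[OF _ _ tendsto_const])
    show "(\<lambda>i. ell2_norm (\<lambda>j. D i j - t j) + ell2_norm (\<lambda>j. E i j - u j)) \<longlonglongrightarrow> 0"
      using tendsto_add[OF t(2) u(2)] by simp
  qed (use ell2_norm_nonneg[OF ell2_add(1)[OF d]] ell2_add(2)[OF d] in \<open>simp_all add: eq\<close>)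
  then show ?thesis
    using row t(1) u(1) by (auto simp: Bs_def ell2_add intro!: bexI[of _ "\<lambda>j. t j + u j"])
qed

lemma Bs_bdd:
  assumes "D \<in> Bs"
  shows "bdd_above (range (\<lambda>i. ell2_norm (D i)))"
proof -
  obtain t where t: "t \<in> ell2" "(\<lambda>i. ell2_norm (\<lambda>j. D i j - t j)) \<longlonglongrightarrow> 0"
    and row: "\<And>i. D i \<in> ell2"
    using assms by (auto simp: Bs_def)
  have "Bseq (\<lambda>i. ell2_norm (\<lambda>j. D i j - t j))"
    using t(2) by (intro convergent_imp_Bseq) (auto simp: convergent_def)
  then obtain K where K: "\<And>i. norm (ell2_norm (\<lambda>j. D i j - t j)) \<le> K"
    by (auto simp: Bseq_def)
  have "ell2_norm (D i) \<le> K + ell2_norm t" for i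
  proof -
    have "ell2_norm (D i) \<le> ell2_norm (\<lambda>j. D i j - t j) + ell2_norm t"
      using ell2_add(2)[OF ell2_diff[OF row t(1)] t(1)] by simp
    then show ?thesis
      using K[of i] by simp
  qed
  then show ?thesis
    by (auto simp: bdd_above_def)
qed

typedef bs_matrix = Bs
  morphisms entry Abs_bs_matrix
  using Bs_zero by blast

setup_lifting type_definition_bs_matrix

lemma Bs_uminus: "D \<in> Bs \<Longrightarrow> (\<lambda>i j. - D i j) \<in> Bs"
  using Bs_scale[of D "-1"] by simp

lemma Bs_minus: "D \<in> Bs \<Longrightarrow> E \<in> Bs \<Longrightarrow> (\<lambda>i j. D i j - E i j) \<in> Bs"
  using Bs_add[OF _ Bs_uminus, of D E] by simp

instantiation bs_matrix :: complex_normed_vector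
begin

lift_definition zero_bs_matrix :: bs_matrix is "\<lambda>i j. 0"
  by (rule Bs_zero)

lift_definition plus_bs_matrix :: "bs_matrix \<Rightarrow> bs_matrix \<Rightarrow> bs_matrix"
  is "\<lambda>D E i j. D i j + E i j"
  by (rule Bs_add)

lift_definition uminus_bs_matrix :: "bs_matrix \<Rightarrow> bs_matrix"
  is "\<lambda>D i j. - D i j"
  by (rule Bs_uminus)

lift_definition minus_bs_matrix :: "bs_matrix \<Rightarrow> bs_matrix \<Rightarrow> bs_matrix"
  is "\<lambda>D E i j. D i j - E i j"
  by (rule Bs_minus)

lift_definition scaleC_bs_matrix :: "complex \<Rightarrow> bs_matrix \<Rightarrow> bs_matrix"
  is "\<lambda>a D i j. a * D i j"
  by (rule Bs_scale)

definition scaleR_bs_matrix :: "real \<Rightarrow> bs_matrix \<Rightarrow> bs_matrix"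
  where "scaleR_bs_matrix r D = complex_of_real r *\<^sub>C D"

definition norm_bs_matrix :: "bs_matrix \<Rightarrow> real"
  where "norm_bs_matrix D = (SUP i. ell2_norm (entry D i))"

definition dist_bs_matrix :: "bs_matrix \<Rightarrow> bs_matrix \<Rightarrow> real"
  where "dist_bs_matrix D E = norm (D - E)"

definition sgn_bs_matrix :: "bs_matrix \<Rightarrow> bs_matrix"
  where "sgn_bs_matrix D = inverse (norm D) *\<^sub>R D"

definition uniformity_bs_matrix :: "(bs_matrix \<times> bs_matrix) filter"
  where "uniformity_bs_matrix = (INF e\<in>{0<..}. principal {(D, E). dist D E < e})"

definition open_bs_matrix :: "bs_matrix set \<Rightarrow> bool"
  where "open_bs_matrix U \<longleftrightarrow> (\<forall>D\<in>U. \<forall>\<^sub>F (D', E) in uniformity. D' = D \<longrightarrow> E \<in> U)"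

instance
proof
  fix D E F :: bs_matrix and r s :: real and a b :: complex
  show "D + E + F = D + (E + F)" "D + E = E + D" "0 + D = D" "- D + D = 0" "D - E = D + - E"
    by (transfer, simp add: algebra_simps)+
  show "r *\<^sub>R (D + E) = r *\<^sub>R D + r *\<^sub>R E" "(r + s) *\<^sub>R D = r *\<^sub>R D + s *\<^sub>R D"
    "r *\<^sub>R s *\<^sub>R D = (r * s) *\<^sub>R D" "1 *\<^sub>R D = D"
    unfolding scaleR_bs_matrix_def by (transfer, simp add: algebra_simps)+
  show "a *\<^sub>C (D + E) = a *\<^sub>C D + a *\<^sub>C E" "(a + b) *\<^sub>C D = a *\<^sub>C D + b *\<^sub>C D"
    "a *\<^sub>C b *\<^sub>C D = (a * b) *\<^sub>C D"
    by (transfer, simp add: algebra_simps)+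
  show "r *\<^sub>R D = complex_of_real r *\<^sub>C D"
    by (rule scaleR_bs_matrix_def)
  show "dist D E = norm (D - E)" "sgn D = inverse (norm D) *\<^sub>R D"
    "uniformity = (INF e\<in>{0<..}. principal {(D::bs_matrix, E). dist D E < e})"
    by (simp_all only: dist_bs_matrix_def sgn_bs_matrix_def uniformity_bs_matrix_def)
  show "open U \<longleftrightarrow> (\<forall>D\<in>U. \<forall>\<^sub>F (D', E) in uniformity. D' = D \<longrightarrow> E \<in> U)" for U :: "bs_matrix set"
    by (simp only: open_bs_matrix_def)
  have row: "entry D i \<in> ell2" for D i
    using entry Bs_row by blast
  have upper: "ell2_norm (entry D i) \<le> norm D" for D i
    unfolding norm_bs_matrix_def by (rule cSUP_upper[OF UNIV_I Bs_bdd[OF entry]])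
  have least: "norm D \<le> B" if "\<And>i. ell2_norm (entry D i) \<le> B" for D B
    unfolding norm_bs_matrix_def using that by (intro cSUP_least) auto
  have nonneg: "0 \<le> norm D" for D :: bs_matrix
    using upper[of D 0] ell2_norm_nonneg[OF row, of D 0] by linarith
  show "norm D = 0 \<longleftrightarrow> D = 0"
  proof
    assume "norm D = 0"
    then have "ell2_norm (entry D i) = 0" for i
      using upper[of D i] ell2_norm_nonneg[OF row, of D i] by linarith
    then have "entry D i j = 0" for i j
      using ell2_norm_eq_0[OF row] by blast
    then show "D = 0"
      by (transfer, auto simp: fun_eq_iff)
  next
    assume "D = 0"
    then show "norm D = 0"
      by (simp add: norm_bs_matrix_def zero_bs_matrix.rep_eq ell2_zero)
  qed
  show "norm (D + E) \<le> norm D + norm E"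
  proof (rule least)
    fix i
    show "ell2_norm (entry (D + E) i) \<le> norm D + norm E"
      using ell2_add(2)[OF row row, of D i E i] upper[of D i] upper[of E i]
      by (simp add: plus_bs_matrix.rep_eq)
  qed
  have ent: "ell2_norm (entry (a *\<^sub>C D) i) = cmod a * ell2_norm (entry D i)" for a D i
    using ell2_scale(2)[OF row] by (simp add: scaleC_bs_matrix.rep_eq)
  have le: "norm (a *\<^sub>C D) \<le> cmod a * norm D" for a and D :: bs_matrix
    by (rule least) (simp add: ent mult_left_mono upper)
  show normC: "norm (a *\<^sub>C D) = cmod a * norm D" for a and D :: bs_matrix
  proof (cases "a = 0")
    case True
    then show ?thesis
      using le[of a D] nonneg[of "a *\<^sub>C D"] by simp
  next
    case False
    have "inverse a *\<^sub>C a *\<^sub>C D = D"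
      using False by (transfer, simp add: field_simps)
    then have "norm D \<le> cmod (inverse a) * norm (a *\<^sub>C D)"
      using le[of "inverse a" "a *\<^sub>C D"] by simp
    then have "cmod a * norm D \<le> norm (a *\<^sub>C D)"
      using False by (simp add: norm_inverse norm_divide field_simps)
    then show ?thesis
      using le[of a D] by simp
  qed
  show "norm (r *\<^sub>R D) = \<bar>r\<bar> * norm D"
    by (simp add: scaleR_bs_matrix_def normC)
qed

end


section \<open>The operator \<open>R\<^sub>G\<close>\<close>

definition matrix_apply :: "bs_matrix \<Rightarrow> (nat \<Rightarrow> 'a::complex_normed_vector) \<Rightarrow> nat \<Rightarrow> 'a"
  where "matrix_apply D g i = (\<Sum>j. entry D i j *\<^sub>C g j)"

definition lim_op :: "(nat \<Rightarrow> 'a::complex_normed_vector) \<Rightarrow> bs_matrix \<Rightarrow> 'a"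
  where "lim_op g D = lim (matrix_apply D g)"

text \<open>
  \<open>bounded_linear\<close> is real linearity with a norm bound. Neither the bound nor the operator
  norm \<open>onorm\<close> depends on the scalar field, so only complex homogeneity has to be added.
\<close>

definition bounded_clinear ::
    "('a::complex_normed_vector \<Rightarrow> 'b::complex_normed_vector) \<Rightarrow> bool"
  where "bounded_clinear f \<longleftrightarrow> bounded_linear f \<and> (\<forall>a x. f (a *\<^sub>C x) = a *\<^sub>C f x)"

end

theory Submission
  imports Defs
begin

text \<open>
  Everything comes from the synthesis map \<open>x \<mapsto> \<Sum>j. x j *\<^sub>C g j\<close> on \<open>\<ell>\<^sup>2\<close>, which is the adjoint of the
  analysis map \<open>h \<mapsto> (\<langle>h, g j\<rangle>)\<^sub>j\<close>; a Bessel bound \<open>C\<close> says that the analysis map has norm at most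
  \<open>sqrt C\<close>, and the same must hold for synthesis.

  For a finite sum \<open>v = \<Sum>j\<in>F. x j *\<^sub>C g j\<close> this is elementary. Expanding \<open>\<langle>v, v\<rangle>\<close> in its first
  argument and applying the Cauchy--Schwarz inequality for finite sums gives
  \<open>\<parallel>v\<parallel>\<^sup>2 \<le> \<parallel>x\<parallel> (\<Sum>j\<in>F. |\<langle>v, g j\<rangle>|\<^sup>2)\<^sup>1\<^sup>/\<^sup>2 \<le> \<parallel>x\<parallel> sqrt C \<parallel>v\<parallel>\<close>, and one divides by \<open>\<parallel>v\<parallel>\<close>
  (\<open>norm_finite_synthesis_le\<close>). Completeness extends synthesis to all of \<open>\<ell>\<^sup>2\<close> with the same bound.
  Hence, if the rows of \<open>D\<close> converge to \<open>t\<close> in \<open>\<ell>\<^sup>2\<close>, the vectors \<open>\<Sum>j. D i j *\<^sub>C g j\<close> converge to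
  the synthesis of \<open>t\<close>, and \<open>sqrt C\<close> bounds the norm of the operator \<open>D \<mapsto> lim D g\<close>.

  Conversely, a matrix all of whose rows equal \<open>x\<close> has norm \<open>\<parallel>x\<parallel>\<close> and is mapped to the synthesis of
  \<open>x\<close>, so a bound \<open>K\<close> for the operator is also one for synthesis. Taking for \<open>x\<close> the
  truncations of the sequence \<open>(\<langle>h, g j\<rangle>)\<^sub>j\<close> shows that \<open>K\<^sup>2\<close> is a Bessel bound
  (\<open>bessel_bound_if_synthesis_bound\<close>), so \<open>K\<^sup>2\<close> is at least the optimal one.
\<close>

section \<open>Complex inner products\<close>

lemma cinner_zero_left: "cinner 0 (z::'a::complex_inner) = 0"
  using cinner_add_left[of 0 0 z] by simp

lemma cinner_sum_scaleC_left:
  fixes g :: "'b \<Rightarrow> 'a::complex_inner"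
  shows "cinner (\<Sum>j\<in>F. x j *\<^sub>C g j) h = (\<Sum>j\<in>F. x j * cinner (g j) h)"
  by (induction F rule: infinite_finite_induct)
    (simp_all add: cinner_zero_left cinner_add_left cinner_scaleC_left)

lemma cinner_add_right: "cinner z (x + y) = cinner z x + cinner (z::'a::complex_inner) y"
  by (metis cinner_add_left cinner_commute complex_cnj_add)

lemma Re_cinner_self: "Re (cinner x x) = (norm (x::'a::complex_inner))\<^sup>2"
  by (simp add: cinner_self)

lemma cmod_cinner_commute: "cmod (cinner x y) = cmod (cinner y (x::'a::complex_inner))"
  by (metis cinner_commute complex_mod_cnj)

text \<open>
  The norm already satisfies the triangle inequality, and squaring
  \<open>\<parallel>x + y\<parallel> \<le> \<parallel>x\<parallel> + \<parallel>y\<parallel>\<close> leaves exactly this real form of the Cauchy--Schwarz inequality.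
\<close>

lemma Re_cinner_le:
  fixes x y :: "'a::complex_inner"
  shows "Re (cinner x y) \<le> norm x * norm y"
proof -
  have "(norm (x + y))\<^sup>2 = (norm x)\<^sup>2 + 2 * Re (cinner x y) + (norm y)\<^sup>2"
    using arg_cong[OF cinner_commute[of y x], of Re]
    by (simp flip: Re_cinner_self add: cinner_add_left cinner_add_right)
  moreover have "(norm (x + y))\<^sup>2 \<le> (norm x + norm y)\<^sup>2"
    by (intro power_mono norm_triangle_ineq) simp
  ultimately show ?thesis
    by (simp add: power2_sum)
qed

lemma bounded_linear_scaleC: "bounded_linear (\<lambda>x::'a::complex_normed_vector. a *\<^sub>C x)"
  by (rule bounded_linear_intro[where K = "cmod a"])
    (simp_all add: scaleC_add_right scaleR_scaleC scaleC_scaleC norm_scaleC mult.commute)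

lemma scaleC_diff_left: "(a - b) *\<^sub>C x = a *\<^sub>C x - b *\<^sub>C (x::'a::complex_normed_vector)"
  using scaleC_add_left[of "a - b" b x] by simp


lemma le_of_mult_self_le:
  fixes a b :: real
  assumes "a * a \<le> b * a" "0 \<le> a" "0 \<le> b"
  shows "a \<le> b"
  using assms by (cases "a = 0") (auto simp: mult_le_cancel_right)


section \<open>Synthesis of square-summable sequences\<close>

lemma norm_finite_synthesis_le:
  fixes g :: "nat \<Rightarrow> 'a::complex_inner"
  assumes C: "0 \<le> C" "bessel_bound g C" and F: "finite F"
  shows "norm (\<Sum>j\<in>F. x j *\<^sub>C g j) \<le> sqrt C * L2_set (\<lambda>j. cmod (x j)) F"
proof -
  define v where "v = (\<Sum>j\<in>F. x j *\<^sub>C g j)"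
  have "(\<Sum>j\<in>F. (cmod (cinner v (g j)))\<^sup>2) \<le> C * (norm v)\<^sup>2"
    using C(2) sum_le_suminf[OF _ F, of "\<lambda>j. (cmod (cinner v (g j)))\<^sup>2"]
    unfolding bessel_bound_def by (meson order_trans zero_le_power2)
  then have analysis: "L2_set (\<lambda>j. cmod (cinner v (g j))) F \<le> sqrt C * norm v"
    unfolding L2_set_def using real_sqrt_le_mono by (fastforce simp: real_sqrt_mult)
  have "(norm v)\<^sup>2 = Re (\<Sum>j\<in>F. x j * cinner (g j) v)"
    using cinner_sum_scaleC_left[of x g F v] by (simp add: v_def flip: Re_cinner_self)
  also have "\<dots> \<le> (\<Sum>j\<in>F. cmod (x j) * cmod (cinner v (g j)))"
    using complex_Re_le_cmod[of "x j * cinner (g j) v" for j]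
    by (auto simp: norm_mult cmod_cinner_commute[of v] intro!: sum_mono)
  also have "\<dots> \<le> L2_set (\<lambda>j. cmod (x j)) F * L2_set (\<lambda>j. cmod (cinner v (g j))) F"
    using L2_set_mult_ineq[of "\<lambda>j. cmod (x j)" "\<lambda>j. cmod (cinner v (g j))" F] by simp
  also have "\<dots> \<le> L2_set (\<lambda>j. cmod (x j)) F * (sqrt C * norm v)"
    by (intro mult_left_mono analysis L2_set_nonneg)
  finally have "norm v * norm v \<le> (sqrt C * L2_set (\<lambda>j. cmod (x j)) F) * norm v"
    by (simp add: power2_eq_square mult_ac)
  moreover have "0 \<le> sqrt C * L2_set (\<lambda>j. cmod (x j)) F"
    using C(1) by (simp add: L2_set_nonneg)
  ultimately show ?thesis
    unfolding v_def[symmetric] by (rule le_of_mult_self_le[OF _ norm_ge_zero])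
qed

instance chilbert_space \<subseteq> banach ..

text \<open>
  The finite estimate bounds the blocks of the series by blocks of the convergent series
  \<open>\<Sum>j. |x j|\<^sup>2\<close>, so Cauchy's criterion applies.
\<close>

lemma summable_synthesis:
  fixes g :: "nat \<Rightarrow> 'a::chilbert_space"
  assumes C: "0 \<le> C" "bessel_bound g C" and x: "x \<in> ell2"
  shows "summable (\<lambda>j. x j *\<^sub>C g j)"
  unfolding summable_Cauchy
proof (intro allI impI)
  fix e :: real assume e: "0 < e"
  \<comment> \<open>The summand 1 keeps the denominator positive when \<open>C = 0\<close>.\<close>
  define d where "d = e\<^sup>2 / (C + 1)"
  have "0 < d"
    using e C(1) by (simp add: d_def)
  then obtain N where N: "\<And>m n. m \<ge> N \<Longrightarrow> (\<Sum>j=m..<n. (cmod (x j))\<^sup>2) < d"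
    using x unfolding ell2_def mem_Collect_eq summable_Cauchy
    by (metis abs_ge_self order.strict_trans1 real_norm_def)
  have "norm (\<Sum>j=m..<n. x j *\<^sub>C g j) < e" if "m \<ge> N" for m n
  proof -
    have "norm (\<Sum>j=m..<n. x j *\<^sub>C g j) \<le> sqrt (C * (\<Sum>j=m..<n. (cmod (x j))\<^sup>2))"
      using norm_finite_synthesis_le[OF C, of "{m..<n}" x]
      by (simp add: L2_set_def real_sqrt_mult)
    also have "\<dots> \<le> sqrt (C * d)"
      using N[OF that, of n] C(1) by (intro real_sqrt_le_mono mult_left_mono) auto
    also have "\<dots> < sqrt ((C + 1) * d)"
      using \<open>0 < d\<close> by (simp add: algebra_simps)
    also have "\<dots> = e"
      using e C(1) by (simp add: d_def)
    finally show ?thesis .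
  qed
  then show "\<exists>N. \<forall>m\<ge>N. \<forall>n. norm (\<Sum>j=m..<n. x j *\<^sub>C g j) < e"
    by blast
qed

lemma norm_synthesis_le:
  fixes g :: "nat \<Rightarrow> 'a::chilbert_space"
  assumes C: "0 \<le> C" "bessel_bound g C" and x: "x \<in> ell2"
  shows "norm (\<Sum>j. x j *\<^sub>C g j) \<le> sqrt C * ell2_norm x"
proof (rule LIMSEQ_le_const2)
  show "(\<lambda>n. norm (\<Sum>j<n. x j *\<^sub>C g j)) \<longlonglongrightarrow> norm (\<Sum>j. x j *\<^sub>C g j)"
    by (intro tendsto_norm summable_LIMSEQ summable_synthesis[OF C x])
  have "norm (\<Sum>j<n. x j *\<^sub>C g j) \<le> sqrt C * ell2_norm x" for n
  proof -
    have "L2_set (\<lambda>j. cmod (x j)) {..<n} \<le> ell2_norm x"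
      using x sum_le_suminf[of "\<lambda>j. (cmod (x j))\<^sup>2" "{..<n}"]
      by (simp add: L2_set_def ell2_norm_def ell2_def)
    then show ?thesis
      using norm_finite_synthesis_le[OF C, of "{..<n}" x] C(1)
      by (meson finite_lessThan mult_left_mono order_trans real_sqrt_ge_zero)
  qed
  then show "\<exists>N. \<forall>n\<ge>N. norm (\<Sum>j<n. x j *\<^sub>C g j) \<le> sqrt C * ell2_norm x"
    by blast
qed

text \<open>
  This is the adjoint direction: testing a synthesis bound \<open>K\<close> on the first \<open>n\<close> analysis
  coefficients of \<open>h\<close>, whose squared norm is \<open>S = \<langle>\<Sum>j<n. \<langle>h, g j\<rangle> g j, h\<rangle>\<close>, gives
  \<open>S \<le> K sqrt S \<parallel>h\<parallel>\<close>. Finitely supported sequences suffice, so no convergence question arises.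
\<close>

lemma bessel_bound_if_synthesis_bound:
  fixes g :: "nat \<Rightarrow> 'a::complex_inner"
  assumes K: "0 \<le> K"
    and bound: "\<And>x n. norm (\<Sum>j<n. x j *\<^sub>C g j) \<le> K * L2_set (\<lambda>j. cmod (x j)) {..<n}"
  shows "bessel_bound g (K\<^sup>2)"
proof -
  have le: "(\<Sum>j<n. (cmod (cinner h (g j)))\<^sup>2) \<le> K\<^sup>2 * (norm h)\<^sup>2" for h n
  proof -
    define S where "S = (\<Sum>j<n. (cmod (cinner h (g j)))\<^sup>2)"
    define v where "v = (\<Sum>j<n. cinner h (g j) *\<^sub>C g j)"
    have S: "0 \<le> S"
      by (simp add: S_def sum_nonneg)
    have "cinner v h = (\<Sum>j<n. cinner h (g j) * cnj (cinner h (g j)))"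
      unfolding v_def cinner_sum_scaleC_left by (simp flip: cinner_commute)
    also have "\<dots> = complex_of_real S"
      unfolding S_def of_real_sum by (rule sum.cong[OF refl]) (rule complex_norm_square[symmetric])
    finally have "sqrt S * sqrt S = Re (cinner v h)"
      using S by simp
    also have "\<dots> \<le> norm v * norm h"
      by (rule Re_cinner_le)
    also have "\<dots> \<le> (K * sqrt S) * norm h"
      using bound[where x = "\<lambda>j. cinner h (g j)" and n = n]
      by (intro mult_right_mono) (simp_all add: v_def S_def L2_set_def)
    finally have "sqrt S * sqrt S \<le> (K * norm h) * sqrt S"
      by (simp add: mult_ac)
    then have "sqrt S \<le> K * norm h"
      by (rule le_of_mult_self_le) (use S K in simp_all)
    then show ?thesis
      using S sqrt_le_D by (fastforce simp: S_def power_mult_distrib)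
  qed
  show ?thesis
    unfolding bessel_bound_def
  proof (intro allI conjI)
    fix h
    show *: "summable (\<lambda>j. (cmod (cinner h (g j)))\<^sup>2)"
      by (rule summableI_nonneg_bounded[OF _ le]) simp
    show "(\<Sum>j. (cmod (cinner h (g j)))\<^sup>2) \<le> K\<^sup>2 * (norm h)\<^sup>2"
      by (rule suminf_le_const[OF * le])
  qed
qed


section \<open>The limit operator\<close>

lemma entry_row_in_ell2: "entry D i \<in> ell2"
  using entry Bs_row by blast

lemma ell2_norm_row_le: "ell2_norm (entry D i) \<le> norm D"
  unfolding norm_bs_matrix_def by (rule cSUP_upper[OF UNIV_I Bs_bdd[OF entry]])

lemma convergent_matrix_apply:
  fixes g :: "nat \<Rightarrow> 'a::chilbert_space"
  assumes C: "0 \<le> C" "bessel_bound g C"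
  shows "convergent (matrix_apply D g)"
proof -
  obtain t where t: "t \<in> ell2" "(\<lambda>i. ell2_norm (\<lambda>j. entry D i j - t j)) \<longlonglongrightarrow> 0"
    using entry[of D] by (auto simp: Bs_def)
  have "norm (matrix_apply D g i - (\<Sum>j. t j *\<^sub>C g j))
      \<le> sqrt C * ell2_norm (\<lambda>j. entry D i j - t j)" for i
    using norm_synthesis_le[OF C ell2_diff[OF entry_row_in_ell2[of D i] t(1)]]
      suminf_diff[OF summable_synthesis[OF C entry_row_in_ell2[of D i]]
        summable_synthesis[OF C t(1)]]
    by (simp add: matrix_apply_def scaleC_diff_left)
  moreover have "(\<lambda>i. sqrt C * ell2_norm (\<lambda>j. entry D i j - t j)) \<longlonglongrightarrow> 0"
    using tendsto_mult_left[OF t(2), of "sqrt C"] by simp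
  ultimately have "(\<lambda>i. matrix_apply D g i - (\<Sum>j. t j *\<^sub>C g j)) \<longlonglongrightarrow> 0"
    by (rule Lim_null_comparison[OF always_eventually[OF allI]])
  then show ?thesis
    unfolding convergent_def using Lim_null by blast
qed

lemma matrix_apply_tendsto_lim_op:
  fixes g :: "nat \<Rightarrow> 'a::chilbert_space"
  assumes "0 \<le> C" "bessel_bound g C"
  shows "matrix_apply D g \<longlonglongrightarrow> lim_op g D"
  using convergent_matrix_apply[OF assms] by (simp add: lim_op_def convergent_LIMSEQ_iff)

lemma norm_lim_op_le:
  fixes g :: "nat \<Rightarrow> 'a::chilbert_space"
  assumes C: "0 \<le> C" "bessel_bound g C"
  shows "norm (lim_op g D) \<le> sqrt C * norm D"
proof (rule LIMSEQ_le_const2)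
  show "(\<lambda>i. norm (matrix_apply D g i)) \<longlonglongrightarrow> norm (lim_op g D)"
    by (intro tendsto_norm matrix_apply_tendsto_lim_op[OF C])
  have "norm (matrix_apply D g i) \<le> sqrt C * norm D" for i
    using norm_synthesis_le[OF C entry_row_in_ell2[of D i]] ell2_norm_row_le[of D i] C(1)
    unfolding matrix_apply_def by (meson mult_left_mono order_trans real_sqrt_ge_zero)
  then show "\<exists>N. \<forall>i\<ge>N. norm (matrix_apply D g i) \<le> sqrt C * norm D"
    by blast
qed

lemma lim_op_add:
  fixes g :: "nat \<Rightarrow> 'a::chilbert_space"
  assumes C: "0 \<le> C" "bessel_bound g C"
  shows "lim_op g (D + E) = lim_op g D + lim_op g E"
proof (rule LIMSEQ_unique[OF matrix_apply_tendsto_lim_op[OF C]])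
  have "matrix_apply (D + E) g = (\<lambda>i. matrix_apply D g i + matrix_apply E g i)"
    by (rule ext)
      (simp add: matrix_apply_def plus_bs_matrix.rep_eq scaleC_add_left
        suminf_add[OF summable_synthesis[OF C entry_row_in_ell2]
          summable_synthesis[OF C entry_row_in_ell2]])
  then show "matrix_apply (D + E) g \<longlonglongrightarrow> lim_op g D + lim_op g E"
    using tendsto_add[OF matrix_apply_tendsto_lim_op[OF C] matrix_apply_tendsto_lim_op[OF C]]
    by simp
qed

lemma lim_op_scaleC:
  fixes g :: "nat \<Rightarrow> 'a::chilbert_space"
  assumes C: "0 \<le> C" "bessel_bound g C"
  shows "lim_op g (a *\<^sub>C D) = a *\<^sub>C lim_op g D"
proof (rule LIMSEQ_unique[OF matrix_apply_tendsto_lim_op[OF C]])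
  have "matrix_apply (a *\<^sub>C D) g = (\<lambda>i. a *\<^sub>C matrix_apply D g i)"
    using bounded_linear.suminf[OF bounded_linear_scaleC[of a]
        summable_synthesis[OF C entry_row_in_ell2[of D]]]
    by (intro ext) (simp add: matrix_apply_def scaleC_bs_matrix.rep_eq scaleC_scaleC)
  then show "matrix_apply (a *\<^sub>C D) g \<longlonglongrightarrow> a *\<^sub>C lim_op g D"
    using bounded_linear.tendsto[OF bounded_linear_scaleC matrix_apply_tendsto_lim_op[OF C]]
    by simp
qed

lemma bounded_clinear_lim_op:
  fixes g :: "nat \<Rightarrow> 'a::chilbert_space"
  assumes C: "0 \<le> C" "bessel_bound g C"
  shows "bounded_clinear (lim_op g)"
  unfolding bounded_clinear_def
proof (intro conjI allI)
  show "bounded_linear (lim_op g)"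
    by (rule bounded_linear_intro[where K = "sqrt C"])
      (use norm_lim_op_le[OF C] in
        \<open>simp_all add: lim_op_add[OF C] lim_op_scaleC[OF C] scaleR_scaleC mult.commute\<close>)
qed (rule lim_op_scaleC[OF C])

text \<open>
  Constant rows \<open>x\<close> converge to \<open>x\<close>, which realises synthesis as a restriction of the limit
  operator without changing norms.
\<close>

lemma norm_synthesis_le_onorm_lim_op:
  fixes g :: "nat \<Rightarrow> 'a::chilbert_space"
  assumes lin: "bounded_linear (lim_op g)" and x: "x \<in> ell2"
  shows "norm (\<Sum>j. x j *\<^sub>C g j) \<le> onorm (lim_op g) * ell2_norm x"
proof -
  define D where "D = Abs_bs_matrix (\<lambda>i. x)"
  have "(\<lambda>i. x) \<in> Bs"
    using x by (auto simp: Bs_def ell2_zero intro!: bexI[of _ x])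
  then have D: "entry D = (\<lambda>i. x)"
    by (simp add: D_def Abs_bs_matrix_inverse)
  then have "norm D = ell2_norm x"
    by (simp add: norm_bs_matrix_def)
  moreover have "lim_op g D = (\<Sum>j. x j *\<^sub>C g j)"
    unfolding lim_op_def by (rule limI) (simp add: matrix_apply_def[abs_def] D)
  ultimately show ?thesis
    using onorm[OF lin, of D] by simp
qed

lemma bessel_bound_onorm_lim_op:
  fixes g :: "nat \<Rightarrow> 'a::chilbert_space"
  assumes lin: "bounded_linear (lim_op g)"
  shows "bessel_bound g ((onorm (lim_op g))\<^sup>2)"
proof (rule bessel_bound_if_synthesis_bound[OF onorm_pos_le[OF lin]])
  fix x :: "nat \<Rightarrow> complex" and n :: nat
  define y where "y j = (if j < n then x j else 0)" for j
  have sq: "(\<lambda>j. (cmod (y j))\<^sup>2) sums (\<Sum>j<n. (cmod (x j))\<^sup>2)"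
    using sums_finite[of "{..<n}" "\<lambda>j. (cmod (y j))\<^sup>2"] by (simp add: y_def)
  have y: "y \<in> ell2" "ell2_norm y = L2_set (\<lambda>j. cmod (x j)) {..<n}"
    using sums_summable[OF sq] sums_unique[OF sq]
    by (simp_all add: ell2_def ell2_norm_def L2_set_def)
  have zero: "(0::complex) *\<^sub>C z = 0" for z :: 'a
    using norm_scaleC[of 0 z] by simp
  have "(\<Sum>j. y j *\<^sub>C g j) = (\<Sum>j<n. x j *\<^sub>C g j)"
    using suminf_finite[of "{..<n}" "\<lambda>j. y j *\<^sub>C g j"] by (simp add: y_def zero)
  then show "norm (\<Sum>j<n. x j *\<^sub>C g j) \<le> onorm (lim_op g) * L2_set (\<lambda>j. cmod (x j)) {..<n}"
    using norm_synthesis_le_onorm_lim_op[OF lin y(1)] y(2) by simp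
qed

theorem theorem3p1:
  fixes g :: "nat \<Rightarrow> 'a::chilbert_space"
  assumes separable: "separable_space (euclidean :: 'a topology)"
    and bessel: "bessel_sequence g"
    and bound_pos: "optimal_bessel_bound g > 0"
  shows "(\<forall>D::bs_matrix. (\<forall>i. summable (\<lambda>j. entry D i j *\<^sub>C g j)) \<and>
            convergent (matrix_apply D g)) \<and>
         bounded_clinear (lim_op g) \<and>
         onorm (lim_op g) = sqrt (optimal_bessel_bound g)"
proof -
  note C = optimal_bessel_bound(1,2)[OF bessel]
  have clin: "bounded_clinear (lim_op g)"
    by (rule bounded_clinear_lim_op[OF C])
  then have lin: "bounded_linear (lim_op g)"
    by (simp add: bounded_clinear_def)
  have "onorm (lim_op g) \<le> sqrt (optimal_bessel_bound g)"
    using C(1) by (intro onorm_bound norm_lim_op_le[OF C]) simp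
  moreover have "sqrt (optimal_bessel_bound g) \<le> onorm (lim_op g)"
    using optimal_bessel_bound(3)[OF bessel _ bessel_bound_onorm_lim_op[OF lin]]
    by (intro real_le_lsqrt onorm_pos_le[OF lin]) simp
  ultimately show ?thesis
    using clin summable_synthesis[OF C entry_row_in_ell2] convergent_matrix_apply[OF C]
    by auto
qed

end
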